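(* Let $\mathbb{D}=\{z\in\mathbb{C}:|z|<1\}$. There exist a sequence $\{a_n\}_{n=1}^\infty\subset\mathbb{C}\setminus\overline{\mathbb{D}}$ and a sequence of complex numbers $\{c_n\}_{n=1}^\infty$ with $\sum_{n=1}^\infty|c_n|<+\infty$ such that the function $$f(z)=\sum_{j=1}^\infty\frac{c_j}{z-a_j},\qquad z\in\mathbb{D},$$ is $C^\infty$ on $\overline{\mathbb{D}}$, is nowhere holomorphically extendible over the boundary of $\mathbb{D}$, while its graph $\Gamma_f=\{(z,f(z)):z\in\mathbb{D}\}$ is not complete pluripolar in $\mathbb{C}^2$.
   Context: A set $E\subset\mathbb{C}^2$ is called complete pluripolar in $\mathbb{C}^2$ if there exists a plurisubharmonic function $u$ on $\mathbb{C}^2$ such that $E=\{z\in\mathbb{C}^2:u(z)=-\infty\}$. The condition $\sum_n|c_n|<+\infty$ ensures that the series defining $f$ converges absolutely and locally uniformly on $\mathbb{D}$, so $f$ is holomorphic on $\mathbb{D}$. "$f$ is $C^\infty$ on $\overline{\mathbb{D}}$" means that $f$ and all its derivatives extend continuously from $\mathbb{D}$ to $\overline{\mathbb{D}}$. "Nowhere extendible over the boundary" means that there is no point $b\in\partial\mathbb{D}$ having an open disc $V$ centred at $b$ and a holomorphic function on $V$ that coincides with $f$ on $V\cap\mathbb{D}$. *)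

theory Defs
  imports "HOL-Complex_Analysis.Complex_Analysis"
begin

definition upper_semicontinuous :: "('a::topological_space \<Rightarrow> ereal) \<Rightarrow> bool" where
  "upper_semicontinuous u \<longleftrightarrow> (\<forall>c. open {x. u x < c})"

text \<open>
  The integral over the circle is the integral of the positive part minus that of the negative
  part (\<^const>\<open>e2ennreal\<close> sends negative numbers to 0). For an upper semicontinuous
  function with values below \<open>\<infinity>\<close> the first integral is finite, so the difference is
  well defined and lies in \<open>[-\<infinity>, \<infinity>)\<close>.
\<close>

definition circle_mean :: "(complex \<Rightarrow> ereal) \<Rightarrow> complex \<Rightarrow> real \<Rightarrow> ereal" where
  "circle_mean v z r =
     (enn2ereal (\<integral>\<^sup>+ \<theta> \<in> {0..2 * pi}. e2ennreal (v (z + of_real r * cis \<theta>)) \<partial>lborel)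
      - enn2ereal (\<integral>\<^sup>+ \<theta> \<in> {0..2 * pi}. e2ennreal (- v (z + of_real r * cis \<theta>)) \<partial>lborel))
     / ereal (2 * pi)"

text \<open>
  The constant function \<open>-\<infinity>\<close> counts as subharmonic and as plurisubharmonic.
\<close>

definition subharmonic :: "(complex \<Rightarrow> ereal) \<Rightarrow> bool" where
  "subharmonic v \<longleftrightarrow>
     upper_semicontinuous v \<and> (\<forall>z. v z < \<infinity>) \<and> (\<forall>z. \<forall>r>0. v z \<le> circle_mean v z r)"

definition plurisubharmonic :: "(complex \<times> complex \<Rightarrow> ereal) \<Rightarrow> bool" where
  "plurisubharmonic u \<longleftrightarrow>
     upper_semicontinuous u \<and> (\<forall>p. u p < \<infinity>) \<and>
     (\<forall>p w. subharmonic (\<lambda>t. u (fst p + t * fst w, snd p + t * snd w)))"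

definition complete_pluripolar :: "(complex \<times> complex) set \<Rightarrow> bool" where
  "complete_pluripolar E \<longleftrightarrow> (\<exists>u. plurisubharmonic u \<and> E = {p. u p = -\<infinity>})"

text \<open>
  For holomorphic \<open>f\<close> every partial derivative is a constant multiple of a complex
  derivative, so only the complex derivatives are mentioned. Holomorphy is part of the
  definition because \<^const>\<open>deriv\<close> is otherwise unspecified.
\<close>

definition smooth_on_closed_disc :: "(complex \<Rightarrow> complex) \<Rightarrow> bool" where
  "smooth_on_closed_disc f \<longleftrightarrow>
     f holomorphic_on ball 0 1 \<and>
     (\<forall>k. \<exists>g. continuous_on (cball 0 1) g \<and> (\<forall>z\<in>ball 0 1. g z = (deriv ^^ k) f z))"

definition extendible_at :: "(complex \<Rightarrow> complex) \<Rightarrow> complex \<Rightarrow> bool" where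
  "extendible_at f b \<longleftrightarrow>
     (\<exists>r>0. \<exists>g. g holomorphic_on ball b r \<and> (\<forall>z\<in>ball b r \<inter> ball 0 1. g z = f z))"

definition nowhere_extendible :: "(complex \<Rightarrow> complex) \<Rightarrow> bool" where
  "nowhere_extendible f \<longleftrightarrow> (\<forall>b\<in>sphere 0 1. \<not> extendible_at f b)"

end

theory Submission
  imports Defs
begin

text \<open>
  The idea is to let \<open>-\<infinity>\<close> leak from the open disc to its boundary. The poles \<open>a\<^sub>j\<close> cluster at every
  point of the circle, but each carries such a small coefficient that the series still converges
  outside discs (\<open>holes\<close>) of radius \<open>r\<^sub>j\<close> around the poles, and the \<open>r\<^sub>j\<close> are so small that the holes
  are negligible for logarithmic potential theory. A plurisubharmonic function \<open>u\<close> on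
  the graph of \<open>f\<close> therefore does not notice the holes: if \<open>u = -\<infinity>\<close> on the graph over the open disc, then
  also \<open>u (1, f 1) = -\<infinity>\<close>, and the point \<open>(1, f 1)\<close> does not lie on the graph over the open disc. So
  no \<open>u\<close> has precisely this graph as its \<open>-\<infinity>\<close> set.
  
  In detail, put \<open>g = S\<^sub>n + const\<close>, where \<open>S\<^sub>n\<close> is a partial sum of the series and the constant makes
  \<open>g 1 = f 1\<close>. On \<open>K = {1/2 \<le> |z| \<le> 2}\<close> without the first \<open>n\<close> holes, \<open>g\<close> is bounded by \<open>2\<close>, so
  \<open>u (z, g z) \<le> M\<close> with \<open>M\<close> independent of \<open>n\<close>; on \<open>|z| = 1/2\<close> the function \<open>g\<close> is close to \<open>f\<close>, and
  upper semicontinuity makes \<open>u (z, g z) \<le> M - N\<close> for any prescribed \<open>N\<close> and large \<open>n\<close>. The harmonic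
  function \<open>ln (2 / |z|) / ln 4 - (\<Sum>j<n. ln (4 / |z - a\<^sub>j|) / ln (4 / r\<^sub>j))\<close> is at most \<open>1\<close> on
  \<open>|z| = 1/2\<close>, at most \<open>0\<close> on the rest of the boundary of \<open>K\<close>, and at least \<open>1/2 - 1/4\<close> at the
  point \<open>1\<close>. The maximum principle yields \<open>u (1, f 1) \<le> M - N/4\<close>, and \<open>N\<close> is arbitrary
  (\<open>minus_infinity_propagates_to_boundary_point\<close>).
  
  Plurisubharmonicity only speaks about complex lines, whereas the maximum principle is needed on the
  graph of \<open>g\<close>. The bridge (\<open>plurisubharmonic_maximum_principle_on_graph\<close>) is the doubling of variables
  from the theory of viscosity solutions: maximise \<open>u (z, w)\<close> minus a large multiple of
  \<open>|w - g z|\<^sup>2\<close> over a tube around the graph. At the maximum the penalty touches \<open>u\<close> from above, and on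
  the complex line in the direction \<open>(1, g' z)\<close> the penalty is harmonic up to a term of smaller order
  than the square of the radius. A little strict subharmonicity added to \<open>u\<close> excludes interior maxima.
  
  Smoothness up to the boundary follows from differentiating termwise. For the absence of extensions,
  the coefficients decrease so fast that for each \<open>n\<close> there is an order \<open>k\<close> for which the \<open>k\<close>-th
  derivative at the boundary point \<open>b\<^sub>n\<close> below \<open>a\<^sub>n\<close> is dominated by the single pole \<open>a\<^sub>n\<close> and is at
  least \<open>k! (2\<^sup>n)\<^sup>k\<close>. By Cauchy's inequality this is too large for a holomorphic extension to a
  disc of fixed size that contains infinitely many of the \<open>b\<^sub>n\<close>, and the \<open>b\<^sub>n\<close> come close to every
  boundary point infinitely often.
\<close>

section \<open>Upper semicontinuous functions on compact sets\<close>

text \<open>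
  If no value were maximal, the relatively open sets \<open>{y \<in> E. f y < f x}\<close>, \<open>x \<in> E\<close>, would cover \<open>E\<close>;
  in a finite subcover, no set contains the point \<open>x\<close> with the largest \<open>f x\<close> among its indices.
\<close>

lemma upper_semicontinuous_attains_sup:
  fixes f :: "'a::topological_space \<Rightarrow> 'b::linorder"
  assumes "compact E" "E \<noteq> {}" and usc: "\<And>c. openin (top_of_set E) {x \<in> E. f x < c}"
  obtains m where "m \<in> E" "\<And>x. x \<in> E \<Longrightarrow> f x \<le> f m"
proof -
  have "\<exists>m\<in>E. \<forall>x\<in>E. f x \<le> f m"
  proof (rule ccontr)
    assume "\<not> ?thesis"
    then have above: "\<exists>x\<in>E. f m < f x" if "m \<in> E" for m
      using that by (meson not_le)
    define \<C> where "\<C> = (\<lambda>x. {y \<in> E. f y < f x}) ` E"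
    have "\<forall>C\<in>\<C>. openin (top_of_set E) C" "E \<subseteq> \<Union>\<C>"
      using usc above by (auto simp: \<C>_def)
    then obtain \<D> where \<D>: "\<D> \<subseteq> \<C>" "finite \<D>" "E \<subseteq> \<Union>\<D>"
      using \<open>compact E\<close> unfolding compact_eq_openin_cover by meson
    then obtain X where X: "finite X" "X \<subseteq> E" "\<D> = (\<lambda>x. {y \<in> E. f y < f x}) ` X"
      unfolding \<C>_def by (meson finite_subset_image)
    have "X \<noteq> {}" using \<D> X \<open>E \<noteq> {}\<close> by auto
    then have "Max (f ` X) \<in> f ` X" using X by simp
    then obtain x where x: "x \<in> X" "f x = Max (f ` X)" by auto
    then obtain x' where "x' \<in> X" "f x < f x'" using \<D>(3) X(2,3) by auto
    then show False using x X(1) by (metis Max_ge finite_imageI image_eqI not_le)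
  qed
  then show ?thesis using that by blast
qed

lemma upper_semicontinuous_add_continuous:
  fixes u :: "'a::topological_space \<Rightarrow> ereal"
  assumes u: "upper_semicontinuous u" "\<And>p. u p < \<infinity>" and \<phi>: "continuous_on E \<phi>"
  shows "openin (top_of_set E) {p \<in> E. u p + ereal (\<phi> p) < c}"
proof (cases c)
  case (real d)
  have eq: "u p + ereal (\<phi> p) < c \<longleftrightarrow> (\<exists>q. u p < ereal q \<and> \<phi> p < d - q)" for p
  proof
    assume "u p + ereal (\<phi> p) < c"
    then have "u p < ereal (d - \<phi> p)" using real by (cases "u p") auto
    then obtain q where "u p < ereal q" "ereal q < ereal (d - \<phi> p)" using ereal_dense2 by blast
    then show "\<exists>q. u p < ereal q \<and> \<phi> p < d - q" by (auto intro!: exI[of _ q])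
  next
    assume "\<exists>q. u p < ereal q \<and> \<phi> p < d - q"
    then show "u p + ereal (\<phi> p) < c" using real by (cases "u p") auto
  qed
  have "{p \<in> E. u p + ereal (\<phi> p) < c}
      = (\<Union>q. (E \<inter> {p. u p < ereal q}) \<inter> (E \<inter> \<phi> -` {..< d - q}))"
    by (auto simp: eq)
  moreover have "openin (top_of_set E) ((E \<inter> {p. u p < ereal q}) \<inter> (E \<inter> \<phi> -` {..< d - q}))" for q
    using u(1) \<phi>
    by (intro openin_Int openin_open_Int continuous_openin_preimage_gen)
       (auto simp: upper_semicontinuous_def)
  then have "openin (top_of_set E) (\<Union>q. (E \<inter> {p. u p < ereal q}) \<inter> (E \<inter> \<phi> -` {..< d - q}))"
    by blast
  ultimately show ?thesis by simp
next
  case PInf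
  then have "{p \<in> E. u p + ereal (\<phi> p) < c} = E" using u(2) by auto
  then show ?thesis by simp
qed simp

section \<open>Maximum principle on graphs of holomorphic functions\<close>

text \<open>
  This is the only place where the integrals of \<^const>\<open>circle_mean\<close> are evaluated: everywhere else,
  the mean value property is used by comparison with the real part of a holomorphic function.
\<close>

lemma subharmonic_le_at_centre:
  assumes v: "subharmonic v" and G: "G holomorphic_on ball 0 R" and r: "0 < r" "r < R"
    and le: "\<And>t. norm t = r \<Longrightarrow> v t \<le> ereal (Re (G t))"
  shows "v 0 \<le> ereal (Re (G 0))"
proof -
  define \<phi> where "\<phi> = (\<lambda>\<theta>. Re (G (of_real r * cis \<theta>)))"
  have pt: "of_real r * cis \<theta> \<in> ball 0 R" for \<theta> using r by (simp add: norm_mult)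
  have cont_G: "continuous_on UNIV (\<lambda>\<theta>. G (of_real r * cis \<theta>))"
    by (rule continuous_on_compose2[OF holomorphic_on_imp_continuous_on[OF G]])
       (use pt in \<open>auto intro!: continuous_intros\<close>)
  then have cont: "continuous_on UNIV \<phi>" unfolding \<phi>_def by (intro continuous_intros)
  define \<psi> where "\<psi> = (\<lambda>\<theta>. \<phi> \<theta> * indicator {0..2*pi} \<theta>)"
  have int: "integrable lborel \<psi>" unfolding \<psi>_def
    by (rule borel_integrable_atLeastAtMost) (use cont in \<open>auto simp: continuous_on_eq_continuous_at\<close>)
  \<comment> \<open>Cauchy's formula at the centre of the circle, written as a mean value.\<close>
  have "((\<lambda>u. G u / (u - 0)) has_contour_integral (2 * of_real pi * \<i> * G 0)) (circlepath 0 r)"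
    by (rule Cauchy_integral_circlepath)
       (use G r in \<open>auto intro!: holomorphic_on_imp_continuous_on elim!: holomorphic_on_subset\<close>)
  then have "((\<lambda>\<theta>. G (of_real r * cis \<theta>) / (of_real r * cis \<theta>) * of_real r * \<i> * cis \<theta>)
      has_integral (2 * of_real pi * \<i> * G 0)) {0..2*pi}"
    unfolding circlepath_def by (subst (asm) has_contour_integral_part_circlepath_iff) auto
  then have "((\<lambda>\<theta>. G (of_real r * cis \<theta>) * \<i>) has_integral (2 * of_real pi * \<i> * G 0)) {0..2*pi}"
    by (rule has_integral_eq[rotated]) (use r in \<open>simp add: field_simps\<close>)
  from has_integral_mult_left[OF this, of "-\<i>"]
  have "((\<lambda>\<theta>. G (of_real r * cis \<theta>)) has_integral (2 * of_real pi * G 0)) {0..2*pi}"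
    by (simp add: algebra_simps)
  from has_integral_Re[OF this] have hi: "(\<phi> has_integral (2 * pi * Re (G 0))) {0..2*pi}"
    by (simp add: \<phi>_def)
  have "set_integrable lborel {0..2*pi} \<phi>"
    using int by (simp add: set_integrable_def \<psi>_def mult.commute)
  then have "(LINT x:{0..2*pi}|lborel. \<phi> x) = integral {0..2*pi} \<phi>"
    by (rule set_borel_integral_eq_integral)
  also have "\<dots> = 2 * pi * Re (G 0)" using hi by (rule integral_unique)
  finally have LI: "(\<integral>x. \<psi> x \<partial>lborel) = 2 * pi * Re (G 0)"
    by (simp add: set_lebesgue_integral_def \<psi>_def mult.commute)
  let ?P = "\<integral>\<^sup>+ x. ennreal (\<psi> x) \<partial>lborel" and ?Q = "\<integral>\<^sup>+ x. ennreal (- \<psi> x) \<partial>lborel"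
  have fin: "?P < top" "?Q < top"
    using int by (simp_all add: real_integrable_def less_top)
  have PQ: "enn2ereal ?P - enn2ereal ?Q = ereal (2 * pi * Re (G 0))"
    using LI fin unfolding real_lebesgue_integral_def[OF int]
    by (cases ?P; cases ?Q) auto
  have le': "v (0 + of_real r * cis \<theta>) \<le> ereal (\<phi> \<theta>)" for \<theta>
    using le[of "of_real r * cis \<theta>"] r by (simp add: \<phi>_def norm_mult)
  have "v 0 \<le> circle_mean v 0 r" using v r by (auto simp: subharmonic_def)
  also have "\<dots> \<le> (enn2ereal ?P - enn2ereal ?Q) / ereal (2 * pi)"
    unfolding circle_mean_def
  proof (intro ereal_divide_right_mono ereal_minus_mono)
    have "e2ennreal (v (0 + of_real r * cis \<theta>)) \<le> ennreal (\<phi> \<theta>)" for \<theta>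
      using e2ennreal_mono[OF le'[of \<theta>]] by simp
    then show "enn2ereal (\<integral>\<^sup>+ \<theta> \<in> {0..2 * pi}. e2ennreal (v (0 + of_real r * cis \<theta>)) \<partial>lborel)
        \<le> enn2ereal ?P"
      by (auto simp flip: less_eq_ennreal.rep_eq intro!: nn_integral_mono simp: \<psi>_def indicator_def)
    have "ennreal (- \<phi> \<theta>) \<le> e2ennreal (- v (0 + of_real r * cis \<theta>))" for \<theta>
      using e2ennreal_mono[of "ereal (- \<phi> \<theta>)" "- v (0 + of_real r * cis \<theta>)"] le'[of \<theta>]
      by (metis e2ennreal_ereal ereal_minus_le_minus uminus_ereal.simps(1))
    then show "enn2ereal ?Q
        \<le> enn2ereal (\<integral>\<^sup>+ \<theta> \<in> {0..2 * pi}. e2ennreal (- v (0 + of_real r * cis \<theta>)) \<partial>lborel)"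
      by (auto simp flip: less_eq_ennreal.rep_eq intro!: nn_integral_mono simp: \<psi>_def indicator_def)
  qed simp
  also have "\<dots> = ereal (Re (G 0))" unfolding PQ by simp
  finally show ?thesis .
qed

text \<open>
  Harmonicity near a point, in the form in which it is compared with subharmonic functions.
\<close>

definition harmonic_at :: "(complex \<Rightarrow> real) \<Rightarrow> complex \<Rightarrow> bool" where
  "harmonic_at H z \<longleftrightarrow>
     (\<exists>R>0. \<exists>L. L holomorphic_on ball z R \<and> (\<forall>x\<in>ball z R. H x = Re (L x)))"

lemma harmonic_at_const: "harmonic_at (\<lambda>_. c) z"
  unfolding harmonic_at_def
  by (rule exI[of _ 1], simp, rule exI[of _ "\<lambda>_. of_real c"]) simp

lemma harmonic_at_cmult:
  assumes "harmonic_at H z"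
  shows "harmonic_at (\<lambda>x. c * H x) z"
proof -
  obtain R L where "R > 0" "L holomorphic_on ball z R" "\<forall>x\<in>ball z R. H x = Re (L x)"
    using assms by (auto simp: harmonic_at_def)
  then show ?thesis unfolding harmonic_at_def
    by (intro exI[of _ R] conjI exI[of _ "\<lambda>x. of_real c * L x"]) (auto intro!: holomorphic_intros)
qed

lemma harmonic_at_add:
  assumes "harmonic_at H z" "harmonic_at H' z"
  shows "harmonic_at (\<lambda>x. H x + H' x) z"
proof -
  obtain R L R' L' where "R > 0" "L holomorphic_on ball z R" "\<forall>x\<in>ball z R. H x = Re (L x)"
    and "R' > 0" "L' holomorphic_on ball z R'" "\<forall>x\<in>ball z R'. H' x = Re (L' x)"
    using assms by (auto simp: harmonic_at_def)
  then show ?thesis unfolding harmonic_at_def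
    by (intro exI[of _ "min R R'"] conjI exI[of _ "\<lambda>x. L x + L' x"])
       (auto intro!: holomorphic_intros elim!: holomorphic_on_subset)
qed

lemma harmonic_at_sum:
  assumes "finite J" "\<And>j. j \<in> J \<Longrightarrow> harmonic_at (H j) z"
  shows "harmonic_at (\<lambda>x. \<Sum>j\<in>J. H j x) z"
  using assms by (induction J rule: finite_induct) (auto intro: harmonic_at_const harmonic_at_add)

lemma harmonic_at_ln_norm:
  assumes "z \<noteq> a"
  shows "harmonic_at (\<lambda>x. ln (norm (x - a))) z"
  unfolding harmonic_at_def
proof (intro exI[of _ "norm (z - a)"] conjI ballI
    exI[of _ "\<lambda>x. of_real (ln (norm (z - a))) + Ln (1 + (x - z) / (z - a))"])
  have pos: "0 < Re (1 + (x - z) / (z - a))" if "x \<in> ball z (norm (z - a))" for x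
  proof -
    have "norm ((x - z) / (z - a)) < 1"
      using that assms by (simp add: dist_norm norm_minus_commute norm_divide)
    then show ?thesis
      using abs_Re_le_cmod[of "(x - z) / (z - a)"] by simp
  qed
  show "(\<lambda>x. of_real (ln (norm (z - a))) + Ln (1 + (x - z) / (z - a)))
      holomorphic_on ball z (norm (z - a))"
  proof (intro holomorphic_intros)
    show "1 + (x - z) / (z - a) \<notin> \<real>\<^sub>\<le>\<^sub>0" if "x \<in> ball z (norm (z - a))" for x
      using pos[OF that] by (metis complex_nonpos_Reals_iff not_le)
  qed (use assms in auto)
  show "ln (norm (x - a)) = Re (of_real (ln (norm (z - a))) + Ln (1 + (x - z) / (z - a)))"
    if "x \<in> ball z (norm (z - a))" for x
  proof -
    let ?q = "1 + (x - z) / (z - a)"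
    have "?q \<noteq> 0" using pos[OF that] by (metis less_irrefl zero_complex.sel(1))
    moreover have "x - a = (z - a) * ?q" using assms by (simp add: field_simps)
    ultimately show ?thesis
      using assms by (simp add: norm_mult ln_mult)
  qed
qed (use assms in auto)

text \<open>
  The boundary condition is required on a small tube around the graph of \<open>g\<close> because the maximum of
  the penalised function, although close to the graph, need not lie on it.
\<close>

theorem plurisubharmonic_maximum_principle_on_graph:
  assumes u: "plurisubharmonic u"
    and K: "compact K" "z0 \<in> K"
    and g: "continuous_on K g" "g holomorphic_on interior K"
    and H: "continuous_on K H" "\<And>z. z \<in> interior K \<Longrightarrow> harmonic_at H z"
    and "\<delta> > 0"
    and bd: "\<And>z w. z \<in> K - interior K \<Longrightarrow> norm (w - g z) \<le> \<delta> \<Longrightarrow> u (z, w) \<le> ereal (B - H z)"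
  shows "u (z0, g z0) \<le> ereal (B - H z0)"
proof (rule ccontr)
  assume "\<not> ?thesis"
  then have above: "ereal (B - H z0) < u (z0, g z0)" by simp
  have usc: "upper_semicontinuous u" and fin: "\<And>p. u p < \<infinity>"
    using u by (auto simp: plurisubharmonic_def)
  obtain u0 where u0: "u (z0, g z0) = ereal u0"
    using above fin[of "(z0, g z0)"] by (cases "u (z0, g z0)") auto
  define E where "E = {p. fst p \<in> K \<and> norm (snd p - g (fst p)) \<le> \<delta>}"
  have E_eq: "E = (\<lambda>p. (fst p, g (fst p) + snd p)) ` (K \<times> cball 0 \<delta>)"
  proof (intro equalityI subsetI)
    fix p assume "p \<in> E"
    then show "p \<in> (\<lambda>p. (fst p, g (fst p) + snd p)) ` (K \<times> cball 0 \<delta>)"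
      by (intro image_eqI[of _ _ "(fst p, snd p - g (fst p))"]) (auto simp: E_def)
  qed (auto simp: E_def)
  have g_fst: "continuous_on S (\<lambda>p. g (fst p))" if "fst ` S \<subseteq> K" for S :: "(complex \<times> complex) set"
    by (rule continuous_on_compose2[OF g(1)]) (use that in \<open>auto intro!: continuous_intros\<close>)
  have H_fst: "continuous_on E (\<lambda>p. H (fst p))"
    by (rule continuous_on_compose2[OF H(1)]) (auto simp: E_def intro!: continuous_intros)
  have "compact E" unfolding E_eq
    by (intro compact_continuous_image compact_Times K compact_cball continuous_intros g_fst) auto
  have "(z0, g z0) \<in> E" using K \<open>\<delta> > 0\<close> by (simp add: E_def)
  then have "E \<noteq> {}" by auto
  have attains: "\<exists>m\<in>E. \<forall>p\<in>E. u p + ereal (\<phi> p) \<le> u m + ereal (\<phi> m)" if "continuous_on E \<phi>" for \<phi>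
    using upper_semicontinuous_attains_sup[OF \<open>compact E\<close> \<open>E \<noteq> {}\<close>
        upper_semicontinuous_add_continuous[OF usc fin that]] by metis
  obtain M where M: "\<And>p. p \<in> E \<Longrightarrow> u p \<le> ereal M"
  proof -
    obtain m where m: "\<forall>p\<in>E. u p \<le> u m" using attains[of "\<lambda>_. 0"] by (auto simp flip: zero_ereal_def)
    obtain M where "u m \<le> ereal M" using fin[of m] by (cases "u m") auto
    then show ?thesis using m that by (meson order_trans)
  qed
  obtain R where R: "\<And>z. z \<in> K \<Longrightarrow> norm z \<le> R"
    using compact_imp_bounded[OF K(1)] by (auto simp: bounded_iff)
  obtain h where h: "\<And>z. z \<in> K \<Longrightarrow> H z \<le> h"
    using compact_imp_bounded[OF compact_continuous_image[OF H(1) K(1)]]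
    by (auto simp: bounded_iff) (metis abs_le_D1)
  have gap: "B < u0 + H z0" using above u0 by simp
  \<comment> \<open>So small that adding \<open>\<epsilon> |z|\<^sup>2\<close>, which lies between \<open>0\<close> and \<open>\<epsilon> R\<^sup>2\<close>, does not
      close the gap between the value at \<open>z0\<close> and the bound on the boundary.\<close>
  define \<epsilon> where "\<epsilon> = (u0 + H z0 - B) / (2 * (R\<^sup>2 + 1))"
  have R21: "R\<^sup>2 + 1 > 0" by (simp add: add_nonneg_pos)
  have "\<epsilon> > 0" using gap R21 unfolding \<epsilon>_def by (intro divide_pos_pos) auto
  have half: "\<epsilon> * (R\<^sup>2 + 1) = (u0 + H z0 - B) / 2" 
  proof -
    have "x / (2 * y) * y = x / 2" if "y > 0" for x y :: real using that by simp
    then show ?thesis unfolding \<epsilon>_def using R21 .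
  qed
  have sq_le: "\<epsilon> * (norm z)\<^sup>2 \<le> \<epsilon> * R\<^sup>2" if "z \<in> K" for z
    using R[OF that] \<open>\<epsilon> > 0\<close> by (intro mult_left_mono power_mono) auto
  have gap': "B + \<epsilon> * R\<^sup>2 < u0 + H z0"
    using gap \<open>\<epsilon> > 0\<close> half by (simp add: algebra_simps)
  \<comment> \<open>The factor of the penalty: on the lateral boundary of the tube it outweighs every gain.\<close>
  obtain k where k: "k > 0" "M + h + \<epsilon> * R\<^sup>2 - k * \<delta>\<^sup>2 < u0 + H z0"
  proof
    define A where "A = \<bar>M + h + \<epsilon> * R\<^sup>2 - (u0 + H z0)\<bar> + 1"
    show "A / \<delta>\<^sup>2 > 0" "M + h + \<epsilon> * R\<^sup>2 - A / \<delta>\<^sup>2 * \<delta>\<^sup>2 < u0 + H z0"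
      using \<open>\<delta> > 0\<close> by (auto simp: A_def)
  qed
  define \<phi> where "\<phi> = (\<lambda>p. H (fst p) + \<epsilon> * (norm (fst p))\<^sup>2 - k * (norm (snd p - g (fst p)))\<^sup>2)"
  have "continuous_on E \<phi>" unfolding \<phi>_def
    by (intro continuous_intros H_fst g_fst) (auto simp: E_def)
  then obtain m where m: "m \<in> E" "\<And>p. p \<in> E \<Longrightarrow> u p + ereal (\<phi> p) \<le> u m + ereal (\<phi> m)"
    using attains by blast
  obtain z w where zw: "m = (z, w)" by (cases m)
  have zK: "z \<in> K" and w\<delta>: "norm (w - g z) \<le> \<delta>" using m(1) by (auto simp: E_def zw)
  have "ereal (u0 + H z0) \<le> u (z0, g z0) + ereal (\<phi> (z0, g z0))"
    using \<open>\<epsilon> > 0\<close> by (simp add: u0 \<phi>_def)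
  also have "\<dots> \<le> u m + ereal (\<phi> m)" by (rule m) fact
  finally have top: "ereal (u0 + H z0) \<le> u (z, w) + ereal (\<phi> (z, w))" by (simp add: zw)
  then obtain um where um: "u (z, w) = ereal um" using fin[of "(z, w)"] by (cases "u (z, w)") auto
  have top': "u0 + H z0 \<le> um + \<phi> (z, w)" using top by (simp add: um)
  have z_int: "z \<in> interior K"
  proof (rule ccontr)
    assume "z \<notin> interior K"
    then have "um \<le> B - H z" using bd[of z w] zK w\<delta> um by simp
    moreover have "\<phi> (z, w) \<le> H z + \<epsilon> * R\<^sup>2"
    proof -
      have "0 \<le> k * (norm (w - g z))\<^sup>2" using k(1) by simp
      then show ?thesis using sq_le[OF zK] unfolding \<phi>_def fst_conv snd_conv by linarith
    qed
    ultimately show False using top' gap' by linarith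
  qed
  have w_int: "norm (w - g z) < \<delta>"
  proof (rule ccontr)
    assume "\<not> ?thesis"
    then have "norm (w - g z) = \<delta>" using w\<delta> by simp
    then have "\<phi> (z, w) \<le> h + \<epsilon> * R\<^sup>2 - k * \<delta>\<^sup>2"
      using sq_le[OF zK] h[OF zK] by (simp add: \<phi>_def add_mono)
    moreover have "um \<le> M" using M[OF m(1)] um zw by simp
    ultimately show False using top' k(2) by linarith
  qed
  obtain R1 L where R1: "R1 > 0" and L: "L holomorphic_on ball z R1" "\<And>x. x \<in> ball z R1 \<Longrightarrow> H x = Re (L x)"
    using H(2)[OF z_int] by (auto simp: harmonic_at_def)
  obtain R2 where R2: "R2 > 0" "ball z R2 \<subseteq> interior K"
    using z_int open_interior open_contains_ball by blast
  define g' where "g' = deriv g z"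
  have g': "(g has_field_derivative g') (at z)"
    unfolding g'_def using g(2) z_int open_interior holomorphic_derivI by blast
  define d where "d = w - g z"
  \<comment> \<open>The deviation of the line through \<open>(z, w)\<close> with direction \<open>(1, g')\<close> from the graph. It is a
      holomorphic function of \<open>t\<close> and differs from \<open>d\<close> by \<open>o(|t|)\<close>.\<close>
  define \<psi> where "\<psi> = (\<lambda>t. w + t * g' - g (z + t))"
  \<comment> \<open>Chosen so that the error \<open>k (\<eta> r)\<^sup>2\<close> uses up only half of the gain \<open>\<epsilon> r\<^sup>2\<close>.\<close>
  define \<eta> where "\<eta> = sqrt (\<epsilon> / (2 * k))"
  have \<eta>: "\<eta> > 0" "k * \<eta>\<^sup>2 = \<epsilon> / 2"
    using \<open>\<epsilon> > 0\<close> k(1) by (auto simp: \<eta>_def)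
  obtain R3 where R3: "R3 > 0" "\<And>y. norm (y - z) < R3 \<Longrightarrow> norm (g y - g z - g' * (y - z)) \<le> \<eta> * norm (y - z)"
    using g' \<eta>(1) unfolding has_field_derivative_def has_derivative_at_alt by blast
  have small: "norm (\<psi> t - d) \<le> \<eta> * norm t" if "norm t < R3" for t
  proof -
    have "\<psi> t - d = - (g (z + t) - g z - g' * (z + t - z))" by (simp add: \<psi>_def d_def algebra_simps)
    then show ?thesis using R3(2)[of "z + t"] that by (metis add_diff_cancel_left' norm_minus_cancel)
  qed
  define R4 where "R4 = (\<delta> - norm d) / \<eta>"
  have "R4 > 0" using w_int \<eta>(1) by (simp add: R4_def d_def)
  define \<rho> where "\<rho> = min (min R1 R2) (min R3 R4)"
  have "\<rho> > 0" using R1 R2 R3 \<open>R4 > 0\<close> by (simp add: \<rho>_def)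
  define r where "r = \<rho> / 2"
  have r: "0 < r" "r < \<rho>" using \<open>\<rho> > 0\<close> by (auto simp: r_def)
  \<comment> \<open>Maximality of \<open>(z, w)\<close> gives \<open>u \<le> Re G\<close> on the circle \<open>|t| = r\<close> in the line: up to the
      quadratic terms, collected in \<open>- \<epsilon> / 2 * r\<^sup>2\<close>, all terms of the penalised function
      are real parts of holomorphic functions of \<open>t\<close>.\<close>
  define G where "G = (\<lambda>t. of_real (um + \<phi> (z, w) + k * (norm d)\<^sup>2 - \<epsilon> * (norm z)\<^sup>2 - \<epsilon> / 2 * r\<^sup>2)
      + 2 * of_real k * cnj d * (\<psi> t - d) - L (z + t) - 2 * of_real \<epsilon> * cnj z * t)"
  have shift: "(\<lambda>t. F (z + t)) holomorphic_on ball 0 \<rho>" if "F holomorphic_on ball z \<rho>" for F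
  proof -
    have "(\<lambda>t. z + t) holomorphic_on ball 0 \<rho>" by (intro holomorphic_intros)
    from holomorphic_on_compose_gen[OF this that] show ?thesis
      by (auto simp: o_def dist_norm)
  qed
  have "L holomorphic_on ball z \<rho>" "g holomorphic_on ball z \<rho>"
    using L(1) g(2) R2 by (auto simp: \<rho>_def elim!: holomorphic_on_subset)
  then have G_hol: "G holomorphic_on ball 0 \<rho>"
    unfolding G_def \<psi>_def by (intro holomorphic_intros shift)
  have sub: "subharmonic (\<lambda>t. u (z + t, w + t * g'))"
  proof -
    have "subharmonic (\<lambda>t. u (fst p + t * fst q, snd p + t * snd q))" for p q
      using u by (simp add: plurisubharmonic_def)
    from this[of "(z, w)" "(1, g')"] show ?thesis by simp
  qed
  have "u (z + 0, w + 0 * g') \<le> ereal (Re (G 0))"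
  proof (rule subharmonic_le_at_centre[OF sub G_hol r])
    fix t :: complex assume t: "norm t = r"
    then have t\<rho>: "norm t < R1" "norm t < R2" "norm t < R3" "norm t < R4"
      using r by (auto simp: \<rho>_def)
    have e: "norm (\<psi> t - d) \<le> \<eta> * r" using small t\<rho> t by auto
    have "norm (\<psi> t) \<le> norm d + norm (\<psi> t - d)" by (metis add_diff_cancel_left' diff_add_cancel norm_triangle_ineq add.commute)
    also have "\<dots> \<le> norm d + \<eta> * R4" using e t\<rho>(4) t \<eta>(1)
      by (smt (verit) mult_left_mono)
    also have "\<dots> = \<delta>" using \<eta>(1) by (simp add: R4_def)
    finally have "norm (\<psi> t) \<le> \<delta>" .
    moreover have "z + t \<in> K"
      using R2 t\<rho> interior_subset by (force simp: dist_norm)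
    ultimately have "(z + t, w + t * g') \<in> E" by (simp add: E_def \<psi>_def)
    from m(2)[OF this] have *: "u (z + t, w + t * g') \<le> ereal (um + \<phi> (z, w) - \<phi> (z + t, w + t * g'))"
      using um by (cases "u (z + t, w + t * g')") (auto simp: zw)
    have Lt: "H (z + t) = Re (L (z + t))" using L(2)[of "z + t"] t\<rho> by (simp add: dist_norm)
    have sq: "(norm (x + y))\<^sup>2 = (norm x)\<^sup>2 + 2 * Re (cnj x * y) + (norm y)\<^sup>2" for x y :: complex
      unfolding cmod_power2 by (simp add: power2_eq_square algebra_simps)
    have "k * (norm (\<psi> t))\<^sup>2 = k * (norm d)\<^sup>2 + 2 * k * Re (cnj d * (\<psi> t - d)) + k * (norm (\<psi> t - d))\<^sup>2"
    proof -
      have "(norm (\<psi> t))\<^sup>2 = (norm d)\<^sup>2 + 2 * Re (cnj d * (\<psi> t - d)) + (norm (\<psi> t - d))\<^sup>2"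
        using sq[of d "\<psi> t - d"] by (simp only: add_diff_eq add_diff_cancel_left')
      then show ?thesis by (simp only: distrib_left mult.assoc mult.left_commute)
    qed
    moreover have "k * (norm (\<psi> t - d))\<^sup>2 \<le> k * (\<eta> * r)\<^sup>2"
      using e k(1) by (intro mult_left_mono power_mono) auto
    moreover have "k * (\<eta> * r)\<^sup>2 = \<epsilon> / 2 * r\<^sup>2" using \<eta>(2) by (simp add: power_mult_distrib)
    moreover have "\<epsilon> * (norm (z + t))\<^sup>2 = \<epsilon> * (norm z)\<^sup>2 + 2 * \<epsilon> * Re (cnj z * t) + \<epsilon> * r\<^sup>2"
      unfolding sq[of z t] t by (simp only: distrib_left mult.assoc mult.left_commute)
    moreover have "\<phi> (z + t, w + t * g') = Re (L (z + t)) + \<epsilon> * (norm (z + t))\<^sup>2 - k * (norm (\<psi> t))\<^sup>2"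
      by (simp add: \<phi>_def Lt \<psi>_def)
    moreover have "Re (G t) = um + \<phi> (z, w) + k * (norm d)\<^sup>2 - \<epsilon> * (norm z)\<^sup>2 - \<epsilon> / 2 * r\<^sup>2
        + 2 * k * Re (cnj d * (\<psi> t - d)) - Re (L (z + t)) - 2 * \<epsilon> * Re (cnj z * t)"
      by (simp add: G_def algebra_simps)
    ultimately have "um + \<phi> (z, w) - \<phi> (z + t, w + t * g') \<le> Re (G t)" by linarith
    then show "u (z + t, w + t * g') \<le> ereal (Re (G t))" using * by (metis ereal_less_eq(3) order_trans)
  qed
  moreover have "Re (G 0) = um - \<epsilon> / 2 * r\<^sup>2"
    using L(2)[of z] R1 by (simp add: G_def \<psi>_def d_def \<phi>_def)
  moreover have "0 < \<epsilon> / 2 * r\<^sup>2" using \<open>\<epsilon> > 0\<close> r by simp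
  ultimately show False using um by simp
qed

section \<open>Propagation of minus infinity to the boundary\<close>

lemma sums_tail_half: "(\<lambda>j. (1/2::real) ^ Suc (j + n)) sums (1/2) ^ n"
proof -
  have "(\<lambda>j. (1/2) ^ Suc n * (1/2::real) ^ j) sums ((1/2) ^ Suc n * (1 / (1 - 1/2)))"
    by (intro sums_mult geometric_sums) simp
  then show ?thesis by (simp add: power_add mult_ac)
qed

lemma norm_suminf_minus_partial_sum_le:
  fixes t :: "nat \<Rightarrow> complex"
  assumes t: "\<And>j. norm (t j) \<le> (1/2) ^ Suc j"
  shows "summable t" "norm ((\<Sum>j. t j) - (\<Sum>j<n. t j)) \<le> (1/2) ^ n"
proof -
  show s: "summable t"
    by (rule summable_comparison_test'[OF sums_summable[OF sums_tail_half[of 0]]]) (use t in simp)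
  have s': "summable (\<lambda>j. norm (t (j + n)))"
    by (rule summable_comparison_test'[OF sums_summable[OF sums_tail_half[of n]]]) (use t in simp)
  have "(\<Sum>j. t j) - (\<Sum>j<n. t j) = (\<Sum>j. t (j + n))"
    by (simp add: suminf_split_initial_segment[OF s, of n])
  also have "norm \<dots> \<le> (\<Sum>j. norm (t (j + n)))" by (rule summable_norm[OF s'])
  also have "\<dots> \<le> (\<Sum>j. (1/2) ^ Suc (j + n))"
    by (rule suminf_le[OF _ s' sums_summable[OF sums_tail_half]]) (rule t)
  also have "\<dots> = (1/2) ^ n" by (rule sums_unique[OF sums_tail_half, symmetric])
  finally show "norm ((\<Sum>j. t j) - (\<Sum>j<n. t j)) \<le> (1/2) ^ n" .
qed

text \<open>
  Around every pole \<open>a j\<close> there is a hole of radius \<open>r j\<close> outside of which the \<open>j\<close>-th term is at most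
  \<open>(1/2) ^ Suc j\<close>. The quotient \<open>ln (4 / |z - a j|) / ln (4 / r j)\<close> is harmonic off the pole, equals
  \<open>1\<close> on the edge of the hole and is nonnegative for \<open>|z| \<le> 2\<close>; so it dominates the harmonic measure of
  that edge, and \<open>thin\<close> says that, seen from \<open>b\<close>, all holes together hide at most a quarter of the
  horizon, whereas the circle \<open>|z| = 1/2\<close> alone would occupy half of it in the annulus up to \<open>|z| = 2\<close>.
\<close>

theorem minus_infinity_propagates_to_boundary_point:
  fixes a c :: "nat \<Rightarrow> complex" and r :: "nat \<Rightarrow> real"
  defines "f \<equiv> \<lambda>z. \<Sum>j. c j / (z - a j)"
  assumes r: "\<And>j. 0 < r j" "\<And>j. r j < norm (a j) - 1" and a: "\<And>j. norm (a j) \<le> 2"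
    and c: "\<And>j. norm (c j) \<le> r j * (1/2) ^ Suc j"
    and b: "norm b = 1"
    and thin: "\<And>n. (\<Sum>j<n. ln (4 / norm (b - a j)) / ln (4 / r j)) \<le> 1/4"
    and u: "plurisubharmonic u"
    and u_f: "\<And>z. norm z < 1 \<Longrightarrow> u (z, f z) = -\<infinity>"
  shows "u (b, f b) = -\<infinity>"
proof -
  have usc: "upper_semicontinuous u" and fin: "\<And>p. u p < \<infinity>"
    using u by (auto simp: plurisubharmonic_def)
  have term_le: "norm (c j / (z - a j)) \<le> (1/2) ^ Suc j" if "r j \<le> norm (z - a j)" for j z
  proof -
    have "norm (c j) \<le> norm (z - a j) * (1/2) ^ Suc j"
      using c[of j] that by (meson mult_right_mono order_trans zero_le_divide_1_iff zero_le_numeral zero_le_power)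
    moreover have "0 < norm (z - a j)" using r(1) that by (meson less_le_trans)
    ultimately show ?thesis by (simp add: norm_divide pos_divide_le_eq mult.commute)
  qed
  have far: "r j \<le> norm (z - a j)" if "norm z \<le> 1" for j z
    using r(2)[of j] that norm_triangle_ineq2[of "a j" z] by (simp add: norm_minus_commute)
  define S where "S = (\<lambda>n z. \<Sum>j<n. c j / (z - a j))"
  have f_S: "norm (f z - S n z) \<le> (1/2) ^ n" if "norm z \<le> 1" for n z
    unfolding f_def S_def by (rule norm_suminf_minus_partial_sum_le(2)[OF term_le[OF far[OF that]]])
  have S_le: "norm (S n z) \<le> 1" if "\<And>j. j < n \<Longrightarrow> r j \<le> norm (z - a j)" for n z
  proof -
    have "norm (S n z) \<le> (\<Sum>j<n. (1/2) ^ Suc j)"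
      unfolding S_def by (intro sum_norm_le term_le that) simp
    also have "\<dots> \<le> (\<Sum>j. (1/2) ^ Suc j)"
      using sums_summable[OF sums_tail_half[of 0]] by (intro sum_le_suminf) auto
    also have "\<dots> = 1" using sums_unique[OF sums_tail_half[of 0]] by simp
    finally show ?thesis .
  qed
  have r_le: "r j < 1" for j using r(2)[of j] a[of j] by simp
  have lnr: "ln (4 / r j) > 0" for j using r(1)[of j] r_le[of j] by (intro ln_gt_zero) (simp add: field_simps)

  \<comment> \<open>The product contains all the tubes below: \<open>|w| \<le> |g z| + \<delta> \<le> 3\<close>.\<close>
  let ?B = "cball 0 2 \<times> cball (0::complex) 3 :: (complex \<times> complex) set"
  obtain M where M: "\<And>p. p \<in> ?B \<Longrightarrow> u p \<le> ereal M"
  proof -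
    have "compact ?B" by (intro compact_Times compact_cball)
    moreover have "?B \<noteq> {}" by auto
    ultimately obtain m where m: "\<And>p. p \<in> ?B \<Longrightarrow> u p + ereal 0 \<le> u m + ereal 0"
      using upper_semicontinuous_add_continuous[OF usc fin continuous_on_const]
      by (rule upper_semicontinuous_attains_sup) blast
    obtain M where "u m \<le> ereal M" using fin[of m] by (cases "u m") auto
    then have "u p \<le> ereal M" if "p \<in> ?B" for p
      using m[OF that] by (simp flip: zero_ereal_def)
    then show ?thesis by (rule that)
  qed

  have bound: "u (b, f b) \<le> ereal (M - N / 4)" if "N > 0" for N
  proof -
    define C where "C = sphere (0::complex) (1/2)"
    have cont_f: "continuous_on C f"
    proof (rule uniform_limit_theorem[OF _ _ trivial_limit_sequentially])
      show "\<forall>\<^sub>F n in sequentially. continuous_on C (S n)"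
      proof (intro always_eventually allI)
        fix n
        have "z - a j \<noteq> 0" if "z \<in> C" for z j
          using far[of z j] r(1)[of j] that by (auto simp: C_def)
        then show "continuous_on C (S n)"
          unfolding S_def by (intro continuous_intros) auto
      qed
      show "uniform_limit C S f sequentially"
      proof (rule uniform_limitI)
        fix e :: real assume "e > 0"
        have "(\<lambda>n. (1/2::real) ^ n) \<longlonglongrightarrow> 0" by (rule LIMSEQ_realpow_zero) auto
        then have "\<forall>\<^sub>F n in sequentially. (1/2::real) ^ n < e"
          using \<open>e > 0\<close> by (rule order_tendstoD)
        then show "\<forall>\<^sub>F n in sequentially. \<forall>x\<in>C. dist (S n x) (f x) < e"
        proof eventually_elim
          case (elim n)
          have "norm (S n x - f x) < e" if "norm x = 1/2" for x
            using f_S[of x n] elim that by (simp add: norm_minus_commute)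
          then show ?case by (simp add: C_def dist_norm)
        qed
      qed
    qed
    define U where "U = {p. u p < ereal (M - N)}"
    have "open U" using usc by (auto simp: U_def upper_semicontinuous_def)
    moreover have "compact ((\<lambda>z. (z, f z)) ` C)"
      by (intro compact_continuous_image continuous_intros cont_f) (simp add: C_def)
    moreover have "(\<lambda>z. (z, f z)) ` C \<subseteq> U" using u_f by (auto simp: U_def C_def)
    ultimately obtain e where e: "e > 0" "(\<Union>p\<in>(\<lambda>z. (z, f z)) ` C. cball p e) \<subseteq> U"
      using compact_subset_open_imp_cball_epsilon_subset[of "(\<lambda>z. (z, f z)) ` C" U] by blast
    define \<delta> where "\<delta> = min 1 (e / 3)"
    have "\<delta> > 0" using e by (simp add: \<delta>_def)
    obtain n where n: "(1/2) ^ n < \<delta>" using \<open>\<delta> > 0\<close> real_arch_pow_inv[of \<delta> "1/2"] by auto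
    \<comment> \<open>Upper semicontinuity only bounds \<open>u\<close> from above near a point, so the approximations of \<open>f\<close>
        have to take the exact value at \<open>b\<close>.\<close>
    define g where "g = (\<lambda>z. S n z + (f b - S n b))"
    have near_C: "u (z, w) \<le> ereal (M - N)" if "norm z = 1/2" "norm (w - g z) \<le> \<delta>" for z w
    proof -
      have "norm (w - f z) = norm ((w - g z) + (f b - S n b) - (f z - S n z))"
        by (simp add: g_def)
      also have "\<dots> \<le> norm (w - g z) + norm (f b - S n b) + norm (f z - S n z)"
        using norm_triangle_ineq4[of "(w - g z) + (f b - S n b)" "f z - S n z"]
          norm_triangle_ineq[of "w - g z" "f b - S n b"] by linarith
      also have "\<dots> \<le> \<delta> + (1/2) ^ n + (1/2) ^ n"
        using that b f_S by (intro add_mono) auto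
      also have "\<dots> \<le> e" using n min.cobounded2[of 1 "e / 3"] unfolding \<delta>_def by linarith
      finally have "(z, w) \<in> cball (z, f z) e" by (simp add: dist_Pair_Pair dist_norm norm_minus_commute)
      moreover have "z \<in> C" using that by (simp add: C_def)
      ultimately have "(z, w) \<in> U" using e(2) by blast
      then show ?thesis by (simp add: U_def)
    qed
    define K where "K = {z. norm z \<le> 2 \<and> 1/2 \<le> norm z \<and> (\<forall>j<n. r j \<le> norm (z - a j))}"
    have off: "z \<noteq> a j" if "z \<in> K" "j < n" for z j
      using that r(1)[of j] by (force simp: K_def)
    have K_eq: "K = cball 0 2 \<inter> {z. 1/2 \<le> norm z} \<inter> (\<Inter>j\<in>{..<n}. {z. r j \<le> norm (z - a j)})"
      by (auto simp: K_def)
    have "compact K" unfolding K_eq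
      by (intro compact_Int_closed compact_cball closed_INT ballI closed_Collect_le continuous_intros)
    have edge: "norm z = 2 \<or> norm z = 1/2 \<or> (\<exists>j<n. norm (z - a j) = r j)" if "z \<in> K - interior K" for z
    proof (rule ccontr)
      assume *: "\<not> ?thesis"
      let ?O = "ball 0 2 \<inter> {z. 1/2 < norm z} \<inter> (\<Inter>j\<in>{..<n}. {z. r j < norm (z - a j)})"
      have "open ?O" by (intro open_Int open_INT ballI open_Collect_less continuous_intros) auto
      moreover have "?O \<subseteq> K" by (auto simp: K_def intro: less_imp_le)
      moreover have "z \<in> ?O"
      proof -
        have zK: "norm z \<le> 2" "1/2 \<le> norm z" "\<And>j. j < n \<Longrightarrow> r j \<le> norm (z - a j)"
          using that by (simp_all add: K_def)
        have "norm z \<noteq> 2" "norm z \<noteq> 1/2" "\<And>j. j < n \<Longrightarrow> norm (z - a j) \<noteq> r j"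
          using * by blast+
        then have "norm z < 2" "1/2 < norm z" "\<And>j. j < n \<Longrightarrow> r j < norm (z - a j)"
          using zK unfolding less_eq_real_def by metis+
        then show ?thesis by simp
      qed
      ultimately have "z \<in> interior K" using interiorI[of ?O z K] by blast
      then show False using that by simp
    qed
    have bK: "b \<in> K" using b far by (simp add: K_def)
    \<comment> \<open>The quotients of logarithms are expanded, as \<open>c * (d + (-1) * ln |z - a|)\<close>, into the shape in
        which harmonicity is preserved term by term.\<close>
    define p where "p = (\<lambda>j z. 1 / ln (4 / r j) * (ln 4 + (-1) * ln (norm (z - a j))))"
    define h where "h = (\<lambda>z::complex. 1 / ln 4 * (ln 2 + (-1) * ln (norm (z - 0))))"
    define H where "H = (\<lambda>z. N * (h z + (-1) * (\<Sum>j<n. p j z)))"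
    have p_nonneg: "0 \<le> p j z" if "z \<in> K" "j < n" for j z
    proof -
      have "norm (z - a j) \<le> 4" using norm_triangle_ineq4[of z "a j"] a[of j] that by (simp add: K_def)
      moreover have "0 < norm (z - a j)" using off[OF that] by simp
      ultimately have "ln (norm (z - a j)) \<le> ln 4" by simp
      then show ?thesis using lnr[of j] by (simp add: p_def)
    qed
    have ln4: "ln (4::real) = 2 * ln 2" using ln_realpow[of 2 2] by simp
    have h_le: "h z \<le> 1" if "z \<in> K" for z
    proof -
      have "ln (1/2) \<le> ln (norm z)" using that by (subst ln_le_cancel_iff) (auto simp: K_def)
      then show ?thesis by (simp add: h_def ln4 ln_div)
    qed
    have "u (b, g b) \<le> ereal (M - H b)"
    proof (rule plurisubharmonic_maximum_principle_on_graph[OF u \<open>compact K\<close> bK _ _ _ _ \<open>\<delta> > 0\<close>])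
      show "continuous_on K g" 
        unfolding g_def S_def by (intro continuous_intros) (use off in auto)
      show "g holomorphic_on interior K"
        unfolding g_def S_def by (intro holomorphic_intros) (use off interior_subset in fastforce)+
      show "continuous_on K H"
        unfolding H_def h_def p_def by (intro continuous_intros) (use off in \<open>auto simp: K_def\<close>)
      show "harmonic_at H z" if "z \<in> interior K" for z
      proof -
        have "z \<in> K" using that interior_subset by auto
        then show ?thesis unfolding H_def h_def p_def
          by (intro harmonic_at_cmult harmonic_at_add harmonic_at_sum harmonic_at_const
              harmonic_at_ln_norm off) (auto simp: K_def)
      qed
      fix z w assume z: "z \<in> K - interior K" and w: "norm (w - g z) \<le> \<delta>"
      have sum0: "0 \<le> (\<Sum>j<n. p j z)" using z p_nonneg by (intro sum_nonneg) auto
      show "u (z, w) \<le> ereal (M - H z)"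
      proof (cases "norm z = 1/2")
        case True
        have "ln (norm z) = - ln 2" unfolding True by (simp add: ln_div)
        then have "h z = 1" by (simp add: h_def ln4)
        then have "H z \<le> N" using sum0 \<open>N > 0\<close> by (simp add: H_def)
        then have "ereal (M - N) \<le> ereal (M - H z)" by simp
        then show ?thesis using near_C[OF True w] by (rule order_trans[rotated])
      next
        case False
        have "norm (g z) \<le> norm (S n z) + norm (f b - S n b)" unfolding g_def by (rule norm_triangle_ineq)
        also have "\<dots> \<le> 1 + 1"
          using z S_le[of n z] f_S[of b n] b n by (intro add_mono) (auto simp: K_def \<delta>_def)
        finally have "norm (g z) \<le> 2" by simp
        moreover have "norm w \<le> norm (g z) + norm (w - g z)" 
          using norm_triangle_ineq[of "g z" "w - g z"] by simp
        ultimately have "(z, w) \<in> ?B" using w z by (simp add: K_def \<delta>_def)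
        then have "u (z, w) \<le> ereal M" by (rule M)
        moreover have "H z \<le> 0"
        proof (cases "norm z = 2")
          case True
          then show ?thesis using sum0 \<open>N > 0\<close> by (simp add: H_def h_def mult_le_0_iff)
        next
          case 2: False
          then obtain j where j: "j < n" "norm (z - a j) = r j" using edge[OF z] False by auto
          then have "p j z = 1" using lnr[of j] r(1)[of j] by (simp add: p_def ln_div)
          moreover have "p j z \<le> (\<Sum>j<n. p j z)"
            using j z p_nonneg by (intro member_le_sum) auto
          ultimately show ?thesis using h_le[of z] z \<open>N > 0\<close> by (simp add: H_def mult_le_0_iff)
        qed
        then have "ereal M \<le> ereal (M - H z)" by simp
        ultimately show ?thesis by (rule order_trans)
      qed
    qed
    moreover have "N / 4 \<le> H b"
    proof -
      have "h b = 1/2" using b by (simp add: h_def ln4)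
      moreover have "p j b = ln (4 / norm (b - a j)) / ln (4 / r j)" for j
        using far[of b j] b r(1)[of j] by (subst ln_div) (auto simp: p_def)
      then have "(\<Sum>j<n. p j b) \<le> 1/4" using thin[of n] by simp
      ultimately show ?thesis using \<open>N > 0\<close> by (simp add: H_def)
    qed
    then have "ereal (M - H b) \<le> ereal (M - N / 4)" by simp
    ultimately have "u (b, g b) \<le> ereal (M - N / 4)" by (rule order_trans)
    then show ?thesis by (simp add: g_def)
  qed
  show ?thesis
  proof (cases "u (b, f b)")
    case (real x)
    define N where "N = 4 * (\<bar>M\<bar> + \<bar>x\<bar> + 1)"
    have "x \<le> M - N / 4" using bound[of N] by (simp add: real N_def)
    moreover have "N / 4 = \<bar>M\<bar> + \<bar>x\<bar> + 1" by (simp add: N_def)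
    ultimately have False using abs_ge_self[of M] abs_ge_minus_self[of x] by linarith
    then show ?thesis ..
  qed (use fin[of "(b, f b)"] in auto)
qed

section \<open>Series of simple poles with rapidly decreasing coefficients\<close>

text \<open>
  The termwise \<open>k\<close>-th derivative of \<open>\<Sum>j. c j / (z - a j)\<close>. Unlike \<open>(deriv ^^ k)\<close> of the series, it is
  also meaningful on the unit circle.
\<close>

definition pole_series_deriv :: "(nat \<Rightarrow> complex) \<Rightarrow> (nat \<Rightarrow> complex) \<Rightarrow> nat \<Rightarrow> complex \<Rightarrow> complex" where
  "pole_series_deriv c a k z = (\<Sum>j. (-1) ^ k * fact k * c j / (z - a j) ^ Suc k)"

text \<open>
  The condition \<open>rapid\<close> is the Weierstrass test on the closed disc for all termwise derivatives: the
  distance of \<open>a j\<close> from that disc is \<open>norm (a j) - 1\<close>.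
\<close>

locale rapidly_decreasing_poles =
  fixes a c :: "nat \<Rightarrow> complex"
  assumes outside: "\<And>j. 1 < norm (a j)"
    and rapid: "\<And>k. summable (\<lambda>j. norm (c j) / (norm (a j) - 1) ^ Suc k)"
begin

lemma norm_term_le:
  assumes "norm z \<le> 1"
  shows "norm ((-1) ^ k * fact k * c j / (z - a j) ^ Suc k)
    \<le> fact k * (norm (c j) / (norm (a j) - 1) ^ Suc k)"
proof -
  have "norm (a j) - 1 \<le> norm (z - a j)"
    using norm_triangle_ineq2[of "a j" z] assms by (simp add: norm_minus_commute)
  then have "(norm (a j) - 1) ^ Suc k \<le> norm (z - a j) ^ Suc k"
    using outside[of j] by (intro power_mono) auto
  moreover have "0 < (norm (a j) - 1) ^ Suc k"
    using outside[of j] by (intro zero_less_power) simp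
  ultimately have "norm (c j) / norm (z - a j) ^ Suc k \<le> norm (c j) / (norm (a j) - 1) ^ Suc k"
    by (intro divide_left_mono) (auto intro: mult_pos_pos less_le_trans)
  then show ?thesis
    by (simp only: norm_mult norm_divide norm_power norm_minus_cancel norm_one power_one mult_1
        norm_fact times_divide_eq_right[symmetric]) (rule mult_left_mono, auto)
qed

lemma uniform_limit_pole_series_deriv:
  "uniform_limit (cball 0 1) (\<lambda>n z. \<Sum>j<n. (-1) ^ k * fact k * c j / (z - a j) ^ Suc k)
     (pole_series_deriv c a k) sequentially"
  unfolding pole_series_deriv_def
  by (rule Weierstrass_m_test[OF norm_term_le summable_mult[OF rapid]]) simp

lemma summable_pole_series_deriv:
  assumes "norm z \<le> 1"
  shows "summable (\<lambda>j. (-1) ^ k * fact k * c j / (z - a j) ^ Suc k)"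
  by (rule summable_comparison_test'[OF summable_mult[OF rapid]]) (rule norm_term_le[OF assms])

lemma not_pole: "norm z \<le> 1 \<Longrightarrow> z \<noteq> a j"
  using outside[of j] by auto

lemma continuous_on_pole_series_deriv: "continuous_on (cball 0 1) (pole_series_deriv c a k)"
  by (rule uniform_limit_theorem[OF _ uniform_limit_pole_series_deriv])
     (use not_pole in \<open>auto intro!: always_eventually continuous_intros\<close>)

lemma has_field_derivative_pole_series_deriv:
  assumes "norm z < 1"
  shows "(pole_series_deriv c a k has_field_derivative pole_series_deriv c a (Suc k) z) (at z)"
  unfolding pole_series_deriv_def
proof (rule has_field_derivative_series'(2)[where S = "ball 0 1" and ?x0.0 = 0])
  fix n x assume x: "x \<in> ball (0::complex) 1"
  have nz: "x - a n \<noteq> 0" using not_pole[of x n] x by simp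
  have "((\<lambda>z. (z - a n) ^ Suc k) has_field_derivative
      of_nat (Suc k) * (1 * (x - a n) ^ (Suc k - Suc 0))) (at x within ball 0 1)"
    by (rule DERIV_power) (auto intro!: derivative_eq_intros)
  then have "((\<lambda>z. (z - a n) ^ Suc k) has_field_derivative of_nat (Suc k) * (x - a n) ^ k) (at x within ball 0 1)"
    by simp
  from DERIV_cmult[OF DERIV_inverse_fun[OF this], of "(-1) ^ k * fact k * c n"]
  have "((\<lambda>z. (-1) ^ k * fact k * c n * inverse ((z - a n) ^ Suc k)) has_field_derivative
     (-1) ^ k * fact k * c n * (- (inverse ((x - a n) ^ Suc k) * (of_nat (Suc k) * (x - a n) ^ k)
        * inverse ((x - a n) ^ Suc k)))) (at x within ball 0 1)"
    using nz by (simp add: mult_ac)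
  moreover have "(-1) ^ k * fact k * c n * (- (inverse ((x - a n) ^ Suc k) * (of_nat (Suc k) * (x - a n) ^ k)
        * inverse ((x - a n) ^ Suc k))) = (-1) ^ Suc k * fact (Suc k) * c n / (x - a n) ^ Suc (Suc k)"
  proof -
    have "e * F * d * (- (inverse (y * P) * (N * P) * inverse (y * P))) = (- e) * (N * F) * d / (y * (y * P))"
      if "y \<noteq> 0" "P \<noteq> 0" for e F d y P N :: complex
      using that by (simp add: divide_simps)
    from this[OF nz, of "(x - a n) ^ k" "(-1) ^ k" "fact k" "c n" "of_nat (Suc k)"] nz
    show ?thesis by simp
  qed
  ultimately show "((\<lambda>z. (-1) ^ k * fact k * c n / (z - a n) ^ Suc k) has_field_derivative
     (-1) ^ Suc k * fact (Suc k) * c n / (x - a n) ^ Suc (Suc k)) (at x within ball 0 1)"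
    by (simp only: divide_inverse)
next
  show "uniformly_convergent_on (ball 0 1)
     (\<lambda>n x. \<Sum>j<n. (-1) ^ Suc k * fact (Suc k) * c j / (x - a j) ^ Suc (Suc k))"
    using uniform_limit_on_subset[OF uniform_limit_pole_series_deriv ball_subset_cball]
    unfolding uniformly_convergent_on_def by blast
  show "summable (\<lambda>j. (-1) ^ k * fact k * c j / (0 - a j) ^ Suc k)"
    by (rule summable_pole_series_deriv) simp
qed (use assms in \<open>auto simp: interior_open\<close>)

lemma higher_deriv_pole_series:
  assumes "norm z < 1"
  shows "(deriv ^^ k) (\<lambda>z. \<Sum>j. c j / (z - a j)) z = pole_series_deriv c a k z"
  using assms
proof (induction k arbitrary: z)
  case 0
  show ?case by (simp add: pole_series_deriv_def)
next
  case (Suc k)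
  have "eventually (\<lambda>w. w \<in> ball 0 1) (nhds z)"
    using Suc.prems by (intro eventually_nhds_in_open) auto
  then have "eventually (\<lambda>w. (deriv ^^ k) (\<lambda>z. \<Sum>j. c j / (z - a j)) w = pole_series_deriv c a k w) (nhds z)"
    by eventually_elim (use Suc.IH in auto)
  then have "deriv ((deriv ^^ k) (\<lambda>z. \<Sum>j. c j / (z - a j))) z = deriv (pole_series_deriv c a k) z"
    by (rule deriv_cong_ev) simp
  also have "\<dots> = pole_series_deriv c a (Suc k) z"
    by (rule DERIV_imp_deriv[OF has_field_derivative_pole_series_deriv[OF Suc.prems]])
  finally show ?case by simp
qed

lemma holomorphic_pole_series: "(\<lambda>z. \<Sum>j. c j / (z - a j)) holomorphic_on ball 0 1"
proof -
  have "(\<lambda>z. \<Sum>j. c j / (z - a j)) = pole_series_deriv c a 0"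
    by (simp add: pole_series_deriv_def fun_eq_iff)
  moreover have "pole_series_deriv c a 0 holomorphic_on ball 0 1"
    by (subst holomorphic_on_open) (use has_field_derivative_pole_series_deriv[of _ 0] in \<open>auto intro!: exI\<close>)
  ultimately show ?thesis by simp
qed

theorem smooth_pole_series: "smooth_on_closed_disc (\<lambda>z. \<Sum>j. c j / (z - a j))"
  unfolding smooth_on_closed_disc_def
  using holomorphic_pole_series continuous_on_pole_series_deriv higher_deriv_pole_series
  by (auto intro!: exI[of _ "pole_series_deriv c a _"])

text \<open>
  The derivatives of a holomorphic extension agree with the termwise derivatives also on the circle,
  since both are continuous there, and Cauchy's inequality bounds them.
\<close>

lemma extension_bounds_pole_series_deriv:
  assumes "extendible_at (\<lambda>z. \<Sum>j. c j / (z - a j)) b"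
  obtains \<rho> C where "0 < \<rho>" "0 \<le> C"
    "\<And>x k. norm x = 1 \<Longrightarrow> dist x b < \<rho> \<Longrightarrow> norm (pole_series_deriv c a k x) \<le> fact k * C / \<rho> ^ k"
proof -
  let ?f = "\<lambda>z. \<Sum>j. c j / (z - a j)"
  obtain r g where r: "r > 0" and g: "g holomorphic_on ball b r"
    and eq: "\<And>z. z \<in> ball b r \<inter> ball 0 1 \<Longrightarrow> g z = ?f z"
    using assms unfolding extendible_at_def by blast
  \<comment> \<open>A third of the radius: discs of radius \<open>\<rho>\<close> about points closer than \<open>\<rho>\<close> to \<open>b\<close> lie in the
      compact disc of radius \<open>2 * \<rho>\<close>, on which the extension is bounded.\<close>
  define \<rho> where "\<rho> = r / 3"
  have \<rho>: "0 < \<rho>" "\<rho> < r" using r by (auto simp: \<rho>_def)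
  have cont_g: "continuous_on (cball b (2 * \<rho>)) g"
    using holomorphic_on_imp_continuous_on[OF g] by (rule continuous_on_subset) (use r in \<open>auto simp: \<rho>_def\<close>)
  obtain C where C: "\<And>z. z \<in> cball b (2 * \<rho>) \<Longrightarrow> norm (g z) \<le> C"
    using compact_imp_bounded[OF compact_continuous_image[OF cont_g compact_cball]]
    unfolding bounded_iff by blast
  have "0 \<le> C" using order_trans[OF norm_ge_zero C[of b]] \<rho> by simp
  have "norm (pole_series_deriv c a k x) \<le> fact k * C / \<rho> ^ k" if x: "norm x = 1" "dist x b < \<rho>" for x k
  proof -
    let ?D = "ball b r \<inter> ball 0 1"
    have deriv_eq: "(deriv ^^ k) g z = pole_series_deriv c a k z" if "z \<in> ?D" for z
    proof -
      have "eventually (\<lambda>w. w \<in> ?D) (nhds z)" using that by (intro eventually_nhds_in_open) auto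
      then have "eventually (\<lambda>w. g w = ?f w) (nhds z)" by eventually_elim (rule eq)
      then have "(deriv ^^ k) g z = (deriv ^^ k) ?f z" by (rule higher_deriv_cong_ev) simp
      then show ?thesis using higher_deriv_pole_series that by simp
    qed
    \<comment> \<open>Both sides are continuous at \<open>x\<close>, which is approached along a radius.\<close>
    define t where "t = (\<lambda>n::nat. of_real (1 - 1 / real (n + 2)) * x)"
    have "(\<lambda>n. 1 - 1 / real (n + 2)) \<longlonglongrightarrow> 1" by real_asymp
    from tendsto_mult[OF tendsto_of_real[OF this] tendsto_const[of x]]
    have t: "t \<longlonglongrightarrow> x" unfolding t_def by simp
    have norm_t: "norm (t n) < 1" for n
    proof -
      have "0 \<le> 1 - 1 / real (n + 2)" "1 - 1 / real (n + 2) < 1" by (simp_all add: field_simps)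
      then show ?thesis by (simp only: t_def norm_mult norm_of_real x(1) mult_1_right)
    qed
    have "x \<in> ball b r" using x \<rho> by (simp add: dist_commute)
    then have ev: "eventually (\<lambda>n. t n \<in> ball b r) sequentially"
      using t by (metis open_ball topological_tendstoD)
    have "isCont ((deriv ^^ k) g) x"
      using holomorphic_on_imp_continuous_on[OF holomorphic_higher_deriv[OF g open_ball]] \<open>x \<in> ball b r\<close>
      by (simp add: continuous_on_eq_continuous_at)
    then have lim: "(\<lambda>n. (deriv ^^ k) g (t n)) \<longlonglongrightarrow> (deriv ^^ k) g x"
      using t by (rule isCont_tendsto_compose)
    have lim': "(\<lambda>n. pole_series_deriv c a k (t n)) \<longlonglongrightarrow> pole_series_deriv c a k x"
      using continuous_on_pole_series_deriv t
      by (rule continuous_on_tendsto_compose) (use x norm_t in \<open>auto intro!: always_eventually less_imp_le\<close>)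
    have "eventually (\<lambda>n. (deriv ^^ k) g (t n) = pole_series_deriv c a k (t n)) sequentially"
      using ev by eventually_elim (use deriv_eq norm_t in auto)
    then have "(deriv ^^ k) g x = pole_series_deriv c a k x"
      by (rule LIMSEQ_unique[OF Lim_transform_eventually[OF lim] lim'])
    moreover have "norm ((deriv ^^ k) g x) \<le> fact k * C / \<rho> ^ k"
    proof (rule Cauchy_inequality)
      have sub: "cball x \<rho> \<subseteq> cball b (2 * \<rho>)"
      proof
        fix y assume "y \<in> cball x \<rho>"
        then show "y \<in> cball b (2 * \<rho>)"
          using dist_triangle[of b y x] x(2) by (simp add: dist_commute)
      qed
      show "continuous_on (cball x \<rho>) g" by (rule continuous_on_subset[OF cont_g sub])
      show "g holomorphic_on ball x \<rho>"
        using g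
      proof (rule holomorphic_on_subset)
        have "cball b (2 * \<rho>) \<subseteq> ball b r" using r by (intro cball_subset_ball_iff[THEN iffD2]) (simp add: \<rho>_def)
        then show "ball x \<rho> \<subseteq> ball b r" using sub ball_subset_cball by blast
      qed
      show "norm (g y) \<le> C" if "norm (x - y) = \<rho>" for y
      proof (rule C)
        have "y \<in> cball x \<rho>" using that by (simp add: dist_norm)
        then show "y \<in> cball b (2 * \<rho>)" using sub by blast
      qed
    qed fact
    ultimately show ?thesis by simp
  qed
  then show ?thesis using that \<rho> \<open>0 \<le> C\<close> by blast
qed

end

section \<open>Choice of the poles and coefficients\<close>

definition gap :: "nat \<Rightarrow> real" where
  "gap n = (1/2) ^ Suc n"

text \<open>
  The pole lies at distance \<open>gap n\<close> above the boundary point \<open>cis (sqrt n)\<close>. The angles \<open>sqrt n\<close> tend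
  to infinity with steps that tend to zero, so these points approach every boundary point infinitely
  often.
\<close>

definition pole :: "nat \<Rightarrow> complex" where
  "pole n = of_real (1 + gap n) * cis (sqrt (real n))"

text \<open>
  Chosen to satisfy \<open>ln (4 / hole n) = 2 ^ (n + 3) * ln (4 / gap n)\<close>, which makes the logarithmic size
  of the hole, seen from any point of the circle, at most \<open>(1/2) ^ (n + 3)\<close>.
\<close>

definition hole :: "nat \<Rightarrow> real" where
  "hole n = 4 * (gap n / 4) ^ (2 ^ (n + 3))"

text \<open>
  The first summand of the recursive equation makes the weight negligible compared with powers of
  \<open>gap n\<close> whose exponents grow with the previous weight exponents; the other ones make it small
  compared with the radius \<open>hole n\<close>.
\<close>

primrec weight_exponent :: "nat \<Rightarrow> nat" where
  "weight_exponent 0 = 25"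
| "weight_exponent (Suc n) = (n + 2) * (weight_exponent n + 4) + (n + 4) * 2 ^ (n + 4) + (n + 2)"

definition weight :: "nat \<Rightarrow> real" where
  "weight n = (1/2) ^ weight_exponent n"

lemma gap_pos: "0 < gap n" and gap_le: "gap n \<le> 1/2"
  using power_decreasing[of 1 "Suc n" "1/2::real"] by (auto simp: gap_def)

lemma gap_power: "gap n ^ k = (1/2) ^ (Suc n * k)"
  unfolding gap_def power_mult ..

lemma norm_pole: "norm (pole n) = 1 + gap n"
  using gap_pos[of n] by (simp add: pole_def norm_mult del: of_real_add)

lemma gap_le_dist_pole:
  assumes "norm b = 1"
  shows "gap n \<le> norm (b - pole n)"
  using norm_triangle_ineq2[of "pole n" b] assms by (simp add: norm_minus_commute norm_pole)

lemma hole_pos: "0 < hole n"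
  using gap_pos by (simp add: hole_def)

lemma hole_less_gap: "hole n < gap n"
proof -
  have "(gap n / 4) ^ (2 ^ (n + 3)) < (gap n / 4) ^ 1"
    using gap_pos[of n] gap_le[of n] by (intro power_strict_decreasing) (auto intro: one_less_power simp del: One_nat_def)
  then show ?thesis by (simp add: hole_def)
qed

text \<open>
  Every point of the circle keeps a distance of at least \<open>gap j\<close> from the \<open>j\<close>-th pole, and the radius
  \<open>hole j\<close> is a huge power of \<open>gap j\<close>; the quotient of the logarithms is at most the inverse exponent.
\<close>

lemma sum_logarithmic_size_holes_le:
  assumes "norm b = 1"
  shows "(\<Sum>j<n. ln (4 / norm (b - pole j)) / ln (4 / hole j)) \<le> 1/4"
proof -
  have "ln (4 / norm (b - pole j)) / ln (4 / hole j) \<le> (1/4) * (1/2) ^ Suc j" for j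
  proof -
    have "4 / hole j = (4 / gap j) ^ (2 ^ (j + 3))" by (simp add: hole_def power_divide)
    then have eq: "ln (4 / hole j) = 2 ^ (j + 3) * ln (4 / gap j)"
      using gap_pos[of j] by (simp add: ln_realpow)
    have "1 < 4 / gap j" using gap_pos[of j] gap_le[of j] by (simp add: field_simps)
    then have pos: "0 < ln (4 / gap j)" by (rule ln_gt_zero)
    have "4 / norm (b - pole j) \<le> 4 / gap j"
      using gap_pos[of j] gap_le_dist_pole[OF assms, of j] by (intro divide_left_mono mult_pos_pos) auto
    then have "ln (4 / norm (b - pole j)) \<le> ln (4 / gap j)"
      using gap_pos[of j] gap_le_dist_pole[OF assms, of j] by (intro ln_mono) auto
    then have "ln (4 / norm (b - pole j)) / ln (4 / hole j) \<le> ln (4 / gap j) / ln (4 / hole j)"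
      using pos by (intro divide_right_mono) (auto simp: eq)
    also have "\<dots> = (1/4) * (1/2) ^ Suc j"
      using pos by (simp add: eq power_add power_divide)
    finally show ?thesis .
  qed
  then have "(\<Sum>j<n. ln (4 / norm (b - pole j)) / ln (4 / hole j)) \<le> (\<Sum>j<n. (1/4) * (1/2) ^ Suc j)"
    by (rule sum_mono)
  also have "\<dots> = (1/4) * (\<Sum>j<n. (1/2) ^ Suc j)" by (simp only: sum_distrib_left)
  also have "(\<Sum>j<n. (1/2::real) ^ Suc j) \<le> (\<Sum>j. (1/2) ^ Suc j)"
    using sums_summable[OF sums_tail_half[of 0]] by (intro sum_le_suminf) auto
  also have "\<dots> = 1" using sums_unique[OF sums_tail_half[of 0]] by simp
  finally show ?thesis by simp
qed

lemma weight_exponent_ge: "(n + 3) * 2 ^ (n + 3) + Suc n \<le> weight_exponent n"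
  by (cases n) (auto simp: add_ac)

lemma weight_exponent_superlinear:
  assumes "m < n"
  shows "Suc n * (weight_exponent m + 4) \<le> weight_exponent n"
proof -
  obtain n' where n': "n = Suc n'" "m \<le> n'" using assms by (cases n) auto
  have "weight_exponent k \<le> weight_exponent (Suc k)" for k by simp
  then have "weight_exponent m \<le> weight_exponent n'" using n'(2) by (rule lift_Suc_mono_le)
  then have "(n' + 2) * (weight_exponent m + 4) \<le> (n' + 2) * (weight_exponent n' + 4)" by (intro mult_le_mono) auto
  then show ?thesis using n' by simp
qed

lemma weight_le_hole: "weight n \<le> hole n * (1/2) ^ Suc n"
proof -
  have "gap n / 4 = (1/2) ^ (n + 3)" by (simp add: gap_def power_add power3_eq_cube)
  then have hole: "hole n = 4 * (1/2) ^ ((n + 3) * 2 ^ (n + 3))" by (simp only: hole_def power_mult)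
  have "weight n \<le> (1/2) ^ ((n + 3) * 2 ^ (n + 3) + Suc n)"
    unfolding weight_def by (rule power_decreasing[OF weight_exponent_ge]) auto
  also have "\<dots> = (1/2) ^ ((n + 3) * 2 ^ (n + 3)) * (1/2) ^ Suc n" by (rule power_add)
  also have "\<dots> \<le> hole n * (1/2) ^ Suc n"
    unfolding hole by (intro mult_right_mono) auto
  finally show ?thesis .
qed

lemma weight_le: "weight n \<le> (1/2) ^ Suc n"
proof -
  have "hole n \<le> 1" using hole_less_gap[of n] gap_le[of n] by simp
  then have "hole n * (1/2) ^ Suc n \<le> 1 * (1/2) ^ Suc n" by (intro mult_right_mono) auto
  then show ?thesis using weight_le_hole[of n] by linarith
qed

text \<open>
  The power \<open>weight_exponent m + 3\<close> of the distance is the one at which the \<open>m\<close>-th pole dominates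
  the poles with smaller indices. The bound says that the later poles \<open>n\<close> do not interfere with this.
\<close>

lemma weight_over_gap_power_le:
  assumes "m < n"
  shows "weight n / gap n ^ (weight_exponent m + 3) \<le> (1/2) ^ Suc n"
proof -
  have "weight n \<le> (1/2) ^ (Suc n * (weight_exponent m + 4))"
    unfolding weight_def by (rule power_decreasing[OF weight_exponent_superlinear[OF assms]]) auto
  also have "Suc n * (weight_exponent m + 4) = Suc n + Suc n * (weight_exponent m + 3)" by (simp add: algebra_simps)
  also have "(1/2::real) ^ \<dots> = (1/2) ^ Suc n * gap n ^ (weight_exponent m + 3)"
    unfolding gap_power by (rule power_add)
  finally show ?thesis using gap_pos[of n] by (simp add: pos_divide_le_eq)
qed

interpretation poles: rapidly_decreasing_poles pole "\<lambda>n. of_real (weight n)"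
proof
  show "1 < norm (pole j)" for j using gap_pos by (simp add: norm_pole)
  show "summable (\<lambda>j. norm (complex_of_real (weight j)) / (norm (pole j) - 1) ^ Suc k)" for k
  proof (rule summable_comparison_test'[OF sums_summable[OF sums_tail_half[of 0]]])
    fix j assume j: "Suc k \<le> j"
    have c0: "0 \<le> weight j" by (simp add: weight_def)
    have "k \<le> weight_exponent k" using weight_exponent_ge[of k] by simp
    then have "gap j ^ (weight_exponent k + 3) \<le> gap j ^ Suc k"
      using gap_pos[of j] gap_le[of j] by (intro power_decreasing) auto
    then have "weight j / gap j ^ Suc k \<le> weight j / gap j ^ (weight_exponent k + 3)"
      using c0 gap_pos[of j] by (intro divide_left_mono) auto
    also have "\<dots> \<le> (1/2) ^ Suc j" by (rule weight_over_gap_power_le) (use j in simp)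
    finally show "norm (norm (complex_of_real (weight j)) / (norm (pole j) - 1) ^ Suc k) \<le> (1/2) ^ Suc (j + 0)"
      using c0 gap_pos[of j] by (simp add: norm_pole)
  qed
qed

text \<open>
  At the boundary point below the \<open>n\<close>-th pole, write \<open>W = (2 ^ n) ^ Suc k\<close>. The \<open>n\<close>-th term is
  \<open>k! 8 W\<close>, because \<open>gap n = 1 / (2 * 2 ^ n)\<close> and \<open>2 ^ Suc k\<close> is eight times the inverse weight. The
  earlier poles are at a distance of at least \<open>1 / 2 ^ n\<close> and the weights of the later ones are
  negligible, so that all the other terms together are at most \<open>k! W\<close>.
\<close>

lemma large_derivative_near_pole:
  fixes n :: nat
  defines "k \<equiv> weight_exponent n + 2"
  shows "fact k * (2 ^ n) ^ Suc k
    \<le> norm (pole_series_deriv (\<lambda>n. of_real (weight n)) pole k (cis (sqrt (real n))))"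
proof -
  define b where "b = cis (sqrt (real n))"
  have nb: "norm b = 1" by (simp add: b_def)
  define T where "T = (\<lambda>j. (-1) ^ k * fact k * complex_of_real (weight j) / (b - pole j) ^ Suc k)"
  define W :: real where "W = (2 ^ n) ^ Suc k"
  have W: "1 \<le> W" by (simp add: W_def del: power_Suc)
  have c0: "0 \<le> weight j" for j by (simp add: weight_def)
  have norm_T: "norm (T j) = fact k * (weight j / norm (b - pole j) ^ Suc k)" for j
    using c0[of j] by (simp add: T_def norm_mult norm_divide norm_power del: power_Suc)
  have other: "norm (T j) \<le> fact k * W * (1/2) ^ Suc j" if "j \<noteq> n" for j
  proof -
    have "weight j / norm (b - pole j) ^ Suc k \<le> weight j / gap j ^ Suc k"
      using gap_pos[of j] gap_le_dist_pole[OF nb, of j] c0[of j]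
      by (intro divide_left_mono power_mono mult_pos_pos zero_less_power) auto
    also have "\<dots> \<le> W * (1/2) ^ Suc j"
    proof (cases "j < n")
      case True
      have "(1/2) ^ n \<le> gap j" unfolding gap_def by (rule power_decreasing) (use True in auto)
      then have "((1/2) ^ n) ^ Suc k \<le> gap j ^ Suc k" by (intro power_mono) auto
      moreover have "((1/2::real) ^ n) ^ Suc k = 1 / W" by (simp add: W_def power_one_over del: power_Suc)
      ultimately have "1 \<le> W * gap j ^ Suc k" using W by (simp add: divide_le_eq mult.commute)
      then have "weight j * 1 \<le> (1/2) ^ Suc j * (W * gap j ^ Suc k)"
        using weight_le[of j] c0[of j] by (intro mult_mono) auto
      moreover have "0 < gap j ^ Suc k" by (intro zero_less_power gap_pos)
      ultimately show ?thesis by (simp add: pos_divide_le_eq mult_ac del: power_Suc)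
    next
      case False
      then have "n < j" using that by simp
      have "weight j / gap j ^ Suc k \<le> (1/2) ^ Suc j"
        using weight_over_gap_power_le[OF \<open>n < j\<close>] by (simp add: k_def eval_nat_numeral)
      also have "\<dots> \<le> W * (1/2) ^ Suc j" using mult_right_mono[OF W, of "(1/2) ^ Suc j"] by simp
      finally show ?thesis .
    qed
    finally show ?thesis unfolding norm_T mult.assoc by (intro mult_left_mono) auto
  qed
  have own: "norm (T n) = fact k * (8 * W)"
  proof -
    have "b - pole n = of_real (- gap n) * b" by (simp add: b_def pole_def algebra_simps)
    then have "norm (b - pole n) = gap n" using gap_pos[of n] by (simp only: norm_mult nb) simp
    moreover have "weight n / gap n ^ Suc k = 8 * W"
    proof -
      have "Suc k = weight_exponent n + 3" by (simp add: k_def)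
      then have "8 * weight n = 64 * (1/2) ^ Suc k" by (simp add: weight_def power_add)
      moreover have "gap n ^ Suc k * W = (gap n * 2 ^ n) ^ Suc k" unfolding W_def by (rule power_mult_distrib[symmetric])
      moreover have "gap n * 2 ^ n = 1/2" by (simp add: gap_def power_one_over)
      ultimately have "weight n = 8 * W * gap n ^ Suc k" by (simp add: mult_ac)
      then show ?thesis using gap_pos[of n] by (simp del: power_Suc)
    qed
    ultimately show ?thesis unfolding norm_T by simp
  qed
  define R where "R = (\<lambda>j. if j = n then 0 else T j)"
  have sT: "summable T"
    unfolding T_def by (rule poles.summable_pole_series_deriv) (simp add: nb)
  have R_le: "norm (R j) \<le> fact k * W * (1/2) ^ Suc j" for j
    using other[of j] W by (simp add: R_def)
  have geo: "(\<lambda>j. fact k * W * (1/2) ^ Suc j) sums (fact k * W * 1)"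
    using sums_tail_half[of 0] by (intro sums_mult) simp
  have sR: "summable (\<lambda>j. norm (R j))"
    by (rule summable_comparison_test'[OF sums_summable[OF geo]]) (use R_le in simp)
  have "norm (\<Sum>j. R j) \<le> (\<Sum>j. norm (R j))" by (rule summable_norm[OF sR])
  also have "\<dots> \<le> fact k * W * 1"
    unfolding sums_unique[OF geo] by (rule suminf_le[OF R_le sR sums_summable[OF geo]])
  finally have rest: "norm (\<Sum>j. R j) \<le> fact k * W" by simp
  have "(\<lambda>j. R j + (if j = n then T j else 0)) sums ((\<Sum>j. R j) + T n)"
    by (intro sums_add summable_sums[OF summable_norm_cancel[OF sR]] sums_single)
  moreover have "(\<lambda>j. R j + (if j = n then T j else 0)) = T" by (auto simp: R_def)
  ultimately have "(\<Sum>j. T j) = (\<Sum>j. R j) + T n" using sums_unique by metis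
  then have "norm (T n) \<le> norm (\<Sum>j. T j) + norm (\<Sum>j. R j)"
    by (metis add_diff_cancel_left' norm_triangle_ineq4)
  then have "fact k * (8 * W) \<le> norm (\<Sum>j. T j) + fact k * W" using own rest by linarith
  moreover have "0 \<le> fact k * W" using W by simp
  ultimately have "fact k * W \<le> norm (\<Sum>j. T j)" by linarith
  then show ?thesis by (simp add: pole_series_deriv_def T_def W_def b_def)
qed

text \<open>
  If \<open>b = cis \<theta>\<close>, let \<open>x = \<theta> + 2 \<pi> m\<close> be a large representative of the angle and \<open>n = \<lfloor>x\<^sup>2\<rfloor>\<close>. Then
  \<open>x - sqrt n = (x\<^sup>2 - n) / (x + sqrt n) < 1 / x\<close>.
\<close>

lemma cis_sqrt_dense:
  assumes "norm b = 1" "\<rho> > 0"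
  shows "\<exists>n\<ge>N. dist (cis (sqrt (real n))) b < \<rho>"
proof -
  obtain \<theta> where \<theta>: "b = cis \<theta>"
    using assms(1) by (metis cis_Arg_unique complex_norm_eq_1_exp cis_conv_exp mult.commute)
  have "continuous_on UNIV cis" using continuous_on_cis[OF continuous_on_id, of UNIV] by simp
  then have "isCont cis \<theta>" by (simp add: continuous_on_eq_continuous_at)
  then obtain \<delta> where \<delta>: "\<delta> > 0" "\<And>y. dist y \<theta> < \<delta> \<Longrightarrow> dist (cis y) b < \<rho>"
    using assms(2) unfolding continuous_at_eps_delta \<theta> by blast
  obtain m :: nat where m: "(real N + 1 + 1 / \<delta> + \<bar>\<theta>\<bar>) / (2 * pi) < real m"
    using reals_Archimedean2 by blast
  define x where "x = \<theta> + 2 * pi * real m"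
  have "real N + 1 + 1 / \<delta> + \<bar>\<theta>\<bar> < 2 * pi * real m"
    using m by (simp add: pos_divide_less_eq mult.commute)
  then have x: "real N + 1 + 1 / \<delta> < x" unfolding x_def by linarith
  then have x1: "1 < x" "real N < x" "1 / \<delta> < x"
    using \<delta>(1) by (smt (verit) divide_pos_pos of_nat_0_le_iff)+
  define n where "n = nat \<lfloor>x\<^sup>2\<rfloor>"
  have n: "real n \<le> x\<^sup>2" "x\<^sup>2 < real n + 1"
    unfolding n_def by (auto simp: of_nat_nat)
  have "x \<le> x\<^sup>2" using x1 by (simp add: power2_eq_square)
  then have "real N < real n + 1" using n x1 by linarith
  then have "N \<le> n" by simp
  have le: "sqrt (real n) \<le> x" using n(1) x1 by (intro real_le_lsqrt) auto
  have "(x - sqrt (real n)) * x \<le> (x - sqrt (real n)) * (x + sqrt (real n))"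
    using le by (intro mult_left_mono) auto
  also have "\<dots> = x\<^sup>2 - real n" by (simp add: algebra_simps power2_eq_square)
  also have "\<dots> < 1" using n by simp
  also have "1 < \<delta> * x" using x1(3) \<delta>(1) by (simp add: divide_less_eq mult.commute)
  finally have "x - sqrt (real n) < \<delta>" using x1 by simp
  then have "dist (sqrt (real n) - 2 * pi * real m) \<theta> < \<delta>"
    using le by (simp add: x_def dist_real_def abs_if)
  then have "dist (cis (sqrt (real n) - 2 * pi * real m)) b < \<rho>" by (rule \<delta>(2))
  moreover have "cis (sqrt (real n) - 2 * pi * real m) = cis (sqrt (real n))"
    by (simp add: cis_divide[symmetric] cis_multiple_2pi)
  ultimately show ?thesis using \<open>N \<le> n\<close> by auto
qed

lemma nowhere_extendible_pole_series:
  "nowhere_extendible (\<lambda>z. \<Sum>j. complex_of_real (weight j) / (z - pole j))"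
  unfolding nowhere_extendible_def
proof (intro ballI notI)
  fix b :: complex assume b: "b \<in> sphere 0 1"
    and ext: "extendible_at (\<lambda>z. \<Sum>j. complex_of_real (weight j) / (z - pole j)) b"
  obtain \<rho> C where \<rho>: "0 < \<rho>" and C: "0 \<le> C"
    and le: "\<And>x k. norm x = 1 \<Longrightarrow> dist x b < \<rho> \<Longrightarrow>
        norm (pole_series_deriv (\<lambda>n. of_real (weight n)) pole k x) \<le> fact k * C / \<rho> ^ k"
    using poles.extension_bounds_pole_series_deriv[OF ext] by metis
  obtain N :: nat where N: "max C (1 / \<rho>) < 2 ^ N" using real_arch_pow[of 2 "max C (1 / \<rho>)"] by auto
  obtain n where n: "n \<ge> N" "dist (cis (sqrt (real n))) b < \<rho>"
    using cis_sqrt_dense[of b \<rho> N] b \<rho> by auto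
  have "(2::real) ^ N \<le> 2 ^ n" using n by (intro power_increasing) auto
  then have big: "C < 2 ^ n" "1 / \<rho> < 2 ^ n" using N unfolding max_less_iff_conj by linarith+
  define k where "k = weight_exponent n + 2"
  have "fact k * (2 ^ n) ^ Suc k \<le> fact k * C / \<rho> ^ k"
    using large_derivative_near_pole[of n] le[OF norm_cis n(2), of k] unfolding k_def by (rule order_trans)
  then have "fact k * ((2 ^ n) ^ Suc k) \<le> (fact k :: real) * (C * (1 / \<rho>) ^ k)"
    by (simp add: power_one_over)
  then have "(2 ^ n) ^ Suc k \<le> C * (1 / \<rho>) ^ k"
    by (subst (asm) mult_le_cancel_left_pos) auto
  also have "\<dots> \<le> C * (2 ^ n) ^ k"
    using C big \<rho> by (intro mult_left_mono power_mono) auto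
  also have "\<dots> < 2 ^ n * (2 ^ n) ^ k" using big by (intro mult_strict_right_mono) auto
  finally show False by simp
qed

section \<open>A smooth graph that is not complete pluripolar\<close>

theorem theorem3p2:
  "\<exists>(a :: nat \<Rightarrow> complex) (c :: nat \<Rightarrow> complex).
     (\<forall>n\<ge>1. a n \<notin> cball 0 1) \<and>
     summable (\<lambda>n. norm (c (Suc n))) \<and>
     (let f = (\<lambda>z. \<Sum>j. c (Suc j) / (z - a (Suc j))) in
        smooth_on_closed_disc f \<and>
        nowhere_extendible f \<and>
        \<not> complete_pluripolar {(z, f z) | z. z \<in> ball 0 1})"
proof (intro exI conjI)
  let ?a = "\<lambda>n. pole (n - 1)" and ?c = "\<lambda>n. complex_of_real (weight (n - 1))"
  let ?f = "\<lambda>z. \<Sum>j. complex_of_real (weight j) / (z - pole j)"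
  show "\<forall>n\<ge>1. ?a n \<notin> cball 0 1" using gap_pos by (simp add: norm_pole not_le)
  have c0: "0 \<le> weight j" for j by (simp add: weight_def)
  show "summable (\<lambda>n. norm (?c (Suc n)))"
    by (rule summable_comparison_test'[OF sums_summable[OF sums_tail_half[of 0]]])
       (use weight_le c0 in \<open>simp del: power_Suc\<close>)
  have "\<not> complete_pluripolar {(z, ?f z) | z. z \<in> ball 0 1}"
  proof
    assume "complete_pluripolar {(z, ?f z) | z. z \<in> ball 0 1}"
    then obtain u where u: "plurisubharmonic u" and E: "{(z, ?f z) | z. z \<in> ball 0 1} = {p. u p = -\<infinity>}"
      unfolding complete_pluripolar_def by metis
    have "u (1, ?f 1) = -\<infinity>"
    proof (rule minus_infinity_propagates_to_boundary_point[of hole])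
      show "norm (complex_of_real (weight j)) \<le> hole j * (1/2) ^ Suc j" for j
        using weight_le_hole[of j] c0[of j] by (simp del: power_Suc)
      show "norm (pole j) \<le> 2" for j using gap_le[of j] by (simp add: norm_pole)
      show "u (z, ?f z) = -\<infinity>" if "norm z < 1" for z using E that by auto
    qed (use u hole_pos hole_less_gap sum_logarithmic_size_holes_le in \<open>auto simp: norm_pole\<close>)
    then have "(1, ?f 1) \<in> {(z, ?f z) | z. z \<in> ball 0 1}" using E by simp
    then show False by simp
  qed
  then show "let f = (\<lambda>z. \<Sum>j. ?c (Suc j) / (z - ?a (Suc j))) in
        smooth_on_closed_disc f \<and> nowhere_extendible f \<and>
        \<not> complete_pluripolar {(z, f z) | z. z \<in> ball 0 1}"
    using poles.smooth_pole_series nowhere_extendible_pole_series by simp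
qed

end
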